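(* Let $\mathcal{Q}$ be a small quantaloid. The class of conical presheaves on $\mathcal{Q}$-categories is saturated.
   Context: A quantaloid is a category whose hom-sets are complete lattices and whose composition preserves arbitrary suprema in each variable. $\mathcal{Q}$ is a small quantaloid, with set of objects $\mathcal{Q}_0$. A $\mathcal{Q}$-category $\mathbb{A}$ is a set $\mathbb{A}_0$ with a type function $t:\mathbb{A}_0\to\mathcal{Q}_0$ and $\mathcal{Q}$-arrows $\mathbb{A}(a',a):ta\to ta'$ with $1_{ta}\le\mathbb{A}(a,a)$ and $\mathbb{A}(a'',a')\circ\mathbb{A}(a',a)\le\mathbb{A}(a'',a)$. $\mathbb{A}_X$ denotes the set of objects of type $X$. A functor $F:\mathbb{A}\to\mathbb{B}$ is a type-preserving map with $\mathbb{A}(a',a)\le\mathbb{B}(Fa',Fa)$. A distributor $\Phi$ from $\mathbb{A}$ to $\mathbb{B}$ is a matrix of arrows $\Phi(b,a):ta\to tb$ with $\Phi(b,a')\circ\mathbb{A}(a',a)\le\Phi(b,a)$ and $\mathbb{B}(b,b')\circ\Phi(b',a)\le\Phi(b,a)$. Composition is $(\Psi\otimes\Phi)(c,a)=\bigvee_b\Psi(c,b)\circ\Phi(b,a)$; distributors are ordered elementwise, with elementwise suprema, and form a (large) quantaloid $\mathrm{Dist}(\mathcal{Q})$. For $\Phi:\mathbb{A}\to\mathbb{C}$ and $\Psi:\mathbb{B}\to\mathbb{C}$ in $\mathrm{Dist}(\mathcal{Q})$, the lifting $[\Psi,\Phi]:\mathbb{A}\to\mathbb{B}$ is the largest distributor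 with $\Psi\otimes[\Psi,\Phi]\le\Phi$. A functor $F:\mathbb{A}\to\mathbb{B}$ gives a distributor $\mathbb{B}(F-,-):\mathbb{B}\to\mathbb{A}$. $*_X$ is the one-object $\mathcal{Q}$-category with object of type $X$ and hom-arrow $1_X$. A presheaf on $\mathbb{A}$ is a distributor $\phi:*_X\to\mathbb{A}$, $X\in\mathcal{Q}_0$. Presheaves on $\mathbb{A}$ are the objects of the $\mathcal{Q}$-category $\mathcal{P}(\mathbb{A})$, with $t\phi=X$ and $\mathcal{P}(\mathbb{A})(\psi,\phi)=$ the single element of $[\psi,\phi]$. The representable presheaves are the $\mathbb{A}(-,a):*_{ta}\to\mathbb{A}$. The colimit of $F:\mathbb{A}\to\mathbb{B}$ weighted by a presheaf $\phi:*_X\to\mathbb{A}$ is an object $\mathrm{colim}(\phi,F)$ of $\mathbb{B}$ of type $X$ with $\mathbb{B}(\mathrm{colim}(\phi,F),-)=[\phi,\mathbb{B}(F-,-)]$. In $\mathcal{P}(\mathbb{B})$ all such colimits exist. A presheaf $\phi:*_X\to\mathbb{A}$ is conical if there is a (possibly empty) family $(a_i)_{i\in I}$ in $\mathbb{A}_X$ with $\phi=\bigvee_{i}\mathbb{A}(-,a_i)$ in $\mathrm{Dist}(\mathcal{Q})( *_X,\mathbb{A})$. A class $\mathcal{C}$ of presheaves is saturated if (1) it contains all representable presheaves and (2) for each $\phi:*_X\to\mathbb{A}$ in $\mathcal{C}$ and each functor $G:\mathbb{A}\to\mathcal{P}(\mathbb{B})$ with every $G(a)$ in $\mathcal{C}$,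 $\mathrm{colim}(\phi,G)$ is in $\mathcal{C}$. *)

theory Defs
  imports "HOL-Algebra.Complete_Lattice" "HOL-Library.FuncSet"
begin

section \<open>Quantaloids\<close>

text \<open>
  Each hom-set is an order structure of HOL-Algebra. Arrows do not carry their domain and codomain,
  and hom-sets are not required to be disjoint; a quantaloid with disjoint hom-sets is a particular
  instance. Objects form a set \<open>Obj Q\<close>, so that \<open>Q\<close> is small.
\<close>

record ('o, 'm) quantaloid =
  Obj :: "'o set"
  Hom :: "'o \<Rightarrow> 'o \<Rightarrow> 'm gorder"
  cmp :: "'m \<Rightarrow> 'm \<Rightarrow> 'm" (infixl "\<cdot>\<index>" 70)
  idn :: "'o \<Rightarrow> 'm"

locale quantaloid =
  fixes Q :: "('o, 'm) quantaloid" (structure)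
  assumes hom_complete_lattice:
      "\<lbrakk>X \<in> Obj Q; Y \<in> Obj Q\<rbrakk> \<Longrightarrow> complete_lattice (Hom Q X Y)"
    and cmp_closed:
      "\<lbrakk>X \<in> Obj Q; Y \<in> Obj Q; Z \<in> Obj Q;
        f \<in> carrier (Hom Q X Y); g \<in> carrier (Hom Q Y Z)\<rbrakk>
       \<Longrightarrow> g \<cdot> f \<in> carrier (Hom Q X Z)"
    and idn_closed:
      "X \<in> Obj Q \<Longrightarrow> idn Q X \<in> carrier (Hom Q X X)"
    and cmp_assoc:
      "\<lbrakk>W \<in> Obj Q; X \<in> Obj Q; Y \<in> Obj Q; Z \<in> Obj Q;
        f \<in> carrier (Hom Q W X); g \<in> carrier (Hom Q X Y); h \<in> carrier (Hom Q Y Z)\<rbrakk>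
       \<Longrightarrow> (h \<cdot> g) \<cdot> f = h \<cdot> (g \<cdot> f)"
    and idn_left:
      "\<lbrakk>X \<in> Obj Q; Y \<in> Obj Q; f \<in> carrier (Hom Q X Y)\<rbrakk> \<Longrightarrow> idn Q Y \<cdot> f = f"
    and idn_right:
      "\<lbrakk>X \<in> Obj Q; Y \<in> Obj Q; f \<in> carrier (Hom Q X Y)\<rbrakk> \<Longrightarrow> f \<cdot> idn Q X = f"
    and cmp_sup_right:
      "\<lbrakk>X \<in> Obj Q; Y \<in> Obj Q; Z \<in> Obj Q;
        S \<subseteq> carrier (Hom Q X Y); g \<in> carrier (Hom Q Y Z)\<rbrakk>
       \<Longrightarrow> g \<cdot> (\<Squnion>\<^bsub>Hom Q X Y\<^esub> S) = \<Squnion>\<^bsub>Hom Q X Z\<^esub> ((\<lambda>f. g \<cdot> f) ` S)"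
    and cmp_sup_left:
      "\<lbrakk>X \<in> Obj Q; Y \<in> Obj Q; Z \<in> Obj Q;
        f \<in> carrier (Hom Q X Y); S \<subseteq> carrier (Hom Q Y Z)\<rbrakk>
       \<Longrightarrow> (\<Squnion>\<^bsub>Hom Q Y Z\<^esub> S) \<cdot> f = \<Squnion>\<^bsub>Hom Q X Z\<^esub> ((\<lambda>g. g \<cdot> f) ` S)"


section \<open>Categories enriched in a quantaloid, and functors\<close>

text \<open>\<open>arr A a' a\<close> is the arrow \<open>A(a',a)\<close> from the type of \<open>a\<close> to the type of \<open>a'\<close>.\<close>

record ('o, 'm, 'a) qcat =
  obj :: "'a set"
  ty :: "'a \<Rightarrow> 'o"
  arr :: "'a \<Rightarrow> 'a \<Rightarrow> 'm"

definition qcategory :: "('o, 'm) quantaloid \<Rightarrow> ('o, 'm, 'a) qcat \<Rightarrow> bool" where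
  "qcategory Q A \<longleftrightarrow>
     ty A \<in> obj A \<rightarrow> Obj Q \<and>
     (\<forall>a'\<in>obj A. \<forall>a\<in>obj A. arr A a' a \<in> carrier (Hom Q (ty A a) (ty A a'))) \<and>
     (\<forall>a\<in>obj A. idn Q (ty A a) \<sqsubseteq>\<^bsub>Hom Q (ty A a) (ty A a)\<^esub> arr A a a) \<and>
     (\<forall>a''\<in>obj A. \<forall>a'\<in>obj A. \<forall>a\<in>obj A.
        arr A a'' a' \<cdot>\<^bsub>Q\<^esub> arr A a' a \<sqsubseteq>\<^bsub>Hom Q (ty A a) (ty A a'')\<^esub> arr A a'' a)"

definition qfunctor ::
  "('o, 'm) quantaloid \<Rightarrow> ('o, 'm, 'a) qcat \<Rightarrow> ('o, 'm, 'b) qcat \<Rightarrow> ('a \<Rightarrow> 'b) \<Rightarrow> bool" where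
  "qfunctor Q A B F \<longleftrightarrow>
     F \<in> obj A \<rightarrow> obj B \<and>
     (\<forall>a\<in>obj A. ty B (F a) = ty A a) \<and>
     (\<forall>a'\<in>obj A. \<forall>a\<in>obj A.
        arr A a' a \<sqsubseteq>\<^bsub>Hom Q (ty A a) (ty A a')\<^esub> arr B (F a') (F a))"

definition star :: "('o, 'm) quantaloid \<Rightarrow> 'o \<Rightarrow> ('o, 'm, unit) qcat" where
  "star Q X = \<lparr>obj = UNIV, ty = (\<lambda>_. X), arr = (\<lambda>_ _. idn Q X)\<rparr>"


section \<open>Distributors\<close>

text \<open>
  A distributor from \<open>A\<close> to \<open>B\<close> is a matrix \<open>\<Phi> b a\<close>, normalised to \<open>undefined\<close> off
  \<open>obj B \<times> obj A\<close>, so that equality of HOL functions is equality of distributors.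
\<close>

definition mat :: "'b set \<Rightarrow> 'a set \<Rightarrow> ('b \<Rightarrow> 'a \<Rightarrow> 'm) \<Rightarrow> 'b \<Rightarrow> 'a \<Rightarrow> 'm" where
  "mat I J f = (\<lambda>b a. if b \<in> I \<and> a \<in> J then f b a else undefined)"

definition distributor ::
  "('o, 'm) quantaloid \<Rightarrow> ('o, 'm, 'a) qcat \<Rightarrow> ('o, 'm, 'b) qcat \<Rightarrow> ('b \<Rightarrow> 'a \<Rightarrow> 'm) \<Rightarrow> bool" where
  "distributor Q A B \<Phi> \<longleftrightarrow>
     \<Phi> = mat (obj B) (obj A) \<Phi> \<and>
     (\<forall>b\<in>obj B. \<forall>a\<in>obj A. \<Phi> b a \<in> carrier (Hom Q (ty A a) (ty B b))) \<and>
     (\<forall>b\<in>obj B. \<forall>a'\<in>obj A. \<forall>a\<in>obj A.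
        \<Phi> b a' \<cdot>\<^bsub>Q\<^esub> arr A a' a \<sqsubseteq>\<^bsub>Hom Q (ty A a) (ty B b)\<^esub> \<Phi> b a) \<and>
     (\<forall>b\<in>obj B. \<forall>b'\<in>obj B. \<forall>a\<in>obj A.
        arr B b b' \<cdot>\<^bsub>Q\<^esub> \<Phi> b' a \<sqsubseteq>\<^bsub>Hom Q (ty A a) (ty B b)\<^esub> \<Phi> b a)"

definition Dist ::
  "('o, 'm) quantaloid \<Rightarrow> ('o, 'm, 'a) qcat \<Rightarrow> ('o, 'm, 'b) qcat \<Rightarrow> ('b \<Rightarrow> 'a \<Rightarrow> 'm) gorder" where
  "Dist Q A B =
     \<lparr>carrier = {\<Phi>. distributor Q A B \<Phi>},
      eq = (=),
      le = (\<lambda>\<Phi> \<Psi>. \<forall>b\<in>obj B. \<forall>a\<in>obj A. \<Phi> b a \<sqsubseteq>\<^bsub>Hom Q (ty A a) (ty B b)\<^esub> \<Psi> b a)\<rparr>"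

text \<open>The composite of \<open>\<Phi>\<close> from \<open>A\<close> to \<open>B\<close> with \<open>\<Psi>\<close> from \<open>B\<close> to \<open>C\<close>.\<close>

definition tensor ::
  "('o, 'm) quantaloid \<Rightarrow> ('o, 'm, 'a) qcat \<Rightarrow> ('o, 'm, 'b) qcat \<Rightarrow> ('o, 'm, 'c) qcat \<Rightarrow>
   ('c \<Rightarrow> 'b \<Rightarrow> 'm) \<Rightarrow> ('b \<Rightarrow> 'a \<Rightarrow> 'm) \<Rightarrow> 'c \<Rightarrow> 'a \<Rightarrow> 'm" where
  "tensor Q A B C \<Psi> \<Phi> = mat (obj C) (obj A)
     (\<lambda>c a. \<Squnion>\<^bsub>Hom Q (ty A a) (ty C c)\<^esub> ((\<lambda>b. \<Psi> c b \<cdot>\<^bsub>Q\<^esub> \<Phi> b a) ` obj B))"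

text \<open>The lifting of \<open>\<Phi>\<close> from \<open>A\<close> to \<open>C\<close> through \<open>\<Psi>\<close> from \<open>B\<close> to \<open>C\<close>.\<close>

definition lifting ::
  "('o, 'm) quantaloid \<Rightarrow> ('o, 'm, 'a) qcat \<Rightarrow> ('o, 'm, 'b) qcat \<Rightarrow> ('o, 'm, 'c) qcat \<Rightarrow>
   ('c \<Rightarrow> 'b \<Rightarrow> 'm) \<Rightarrow> ('c \<Rightarrow> 'a \<Rightarrow> 'm) \<Rightarrow> 'b \<Rightarrow> 'a \<Rightarrow> 'm" where
  "lifting Q A B C \<Psi> \<Phi> =
     (THE \<Theta>. greatest (Dist Q A B) \<Theta>
        {\<Theta> \<in> carrier (Dist Q A B). tensor Q A B C \<Psi> \<Theta> \<sqsubseteq>\<^bsub>Dist Q A C\<^esub> \<Phi>})"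

text \<open>The distributor \<open>B(F-,-)\<close> from \<open>B\<close> to \<open>A\<close> given by a functor \<open>F\<close> from \<open>A\<close> to \<open>B\<close>.\<close>

definition functor_dist ::
  "('o, 'm, 'a) qcat \<Rightarrow> ('o, 'm, 'b) qcat \<Rightarrow> ('a \<Rightarrow> 'b) \<Rightarrow> 'a \<Rightarrow> 'b \<Rightarrow> 'm" where
  "functor_dist A B F = mat (obj A) (obj B) (\<lambda>a b. arr B (F a) b)"


section \<open>Presheaves\<close>

text \<open>A presheaf is stored together with its type \<open>X\<close>, as a pair \<open>(X, \<phi>)\<close>.\<close>

type_synonym ('o, 'm, 'a) presheaf = "'o \<times> ('a \<Rightarrow> unit \<Rightarrow> 'm)"

definition presheaf ::
  "('o, 'm) quantaloid \<Rightarrow> ('o, 'm, 'a) qcat \<Rightarrow> ('o, 'm, 'a) presheaf \<Rightarrow> bool" where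
  "presheaf Q A p \<longleftrightarrow> fst p \<in> Obj Q \<and> snd p \<in> carrier (Dist Q (star Q (fst p)) A)"

definition presheaf_cat ::
  "('o, 'm) quantaloid \<Rightarrow> ('o, 'm, 'a) qcat \<Rightarrow> ('o, 'm, ('o, 'm, 'a) presheaf) qcat" where
  "presheaf_cat Q A =
     \<lparr>obj = {p. presheaf Q A p},
      ty = fst,
      arr = (\<lambda>q p. lifting Q (star Q (fst p)) (star Q (fst q)) A (snd q) (snd p) () ())\<rparr>"

definition rep_dist :: "('o, 'm, 'a) qcat \<Rightarrow> 'a \<Rightarrow> 'a \<Rightarrow> unit \<Rightarrow> 'm" where
  "rep_dist A a = mat (obj A) UNIV (\<lambda>x _. arr A x a)"

definition representable :: "('o, 'm, 'a) qcat \<Rightarrow> 'a \<Rightarrow> ('o, 'm, 'a) presheaf" where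
  "representable A a = (ty A a, rep_dist A a)"


section \<open>Weighted colimits\<close>

text \<open>
  The distributor \<open>B(c,-)\<close> from \<open>B\<close> to the one-object category is the one given by the functor
  with constant value \<open>c\<close>.
\<close>

definition is_colim ::
  "('o, 'm) quantaloid \<Rightarrow> ('o, 'm, 'a) qcat \<Rightarrow> ('o, 'm, 'b) qcat \<Rightarrow>
   ('o, 'm, 'a) presheaf \<Rightarrow> ('a \<Rightarrow> 'b) \<Rightarrow> 'b \<Rightarrow> bool" where
  "is_colim Q A B p F c \<longleftrightarrow>
     c \<in> obj B \<and> ty B c = fst p \<and>
     functor_dist (star Q (fst p)) B (\<lambda>_. c) =
       lifting Q B (star Q (fst p)) A (snd p) (functor_dist A B F)"

text \<open>
  A colimit is unique only up to isomorphism in general, and unique in a presheaf category.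
\<close>

definition colim ::
  "('o, 'm) quantaloid \<Rightarrow> ('o, 'm, 'a) qcat \<Rightarrow> ('o, 'm, 'b) qcat \<Rightarrow>
   ('o, 'm, 'a) presheaf \<Rightarrow> ('a \<Rightarrow> 'b) \<Rightarrow> 'b" where
  "colim Q A B p F = (SOME c. is_colim Q A B p F c)"


section \<open>Saturated classes of presheaves\<close>

text \<open>
  A class of presheaves is a set of pairs \<open>(A, p)\<close> with \<open>p\<close> a presheaf on the category \<open>A\<close>. The
  objects of the categories \<open>A\<close> range over an arbitrary type \<open>'u\<close>, which plays the role of the
  universe of sets; a presheaf category itself need not have its objects in \<open>'u\<close>.
\<close>

type_synonym ('o, 'm, 'u) presheaf_class = "(('o, 'm, 'u) qcat \<times> ('o, 'm, 'u) presheaf) set"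

definition all_presheaves :: "('o, 'm) quantaloid \<Rightarrow> ('o, 'm, 'u) presheaf_class" where
  "all_presheaves Q = {(A, p). qcategory Q A \<and> presheaf Q A p}"

definition saturated :: "('o, 'm) quantaloid \<Rightarrow> ('o, 'm, 'u) presheaf_class \<Rightarrow> bool" where
  "saturated Q \<C> \<longleftrightarrow>
     \<C> \<subseteq> all_presheaves Q \<and>
     (\<forall>A. qcategory Q A \<longrightarrow> (\<forall>a\<in>obj A. (A, representable A a) \<in> \<C>)) \<and>
     (\<forall>A B p G. qcategory Q A \<and> qcategory Q B \<and> (A, p) \<in> \<C> \<and>
        qfunctor Q A (presheaf_cat Q B) G \<and> (\<forall>a\<in>obj A. (B, G a) \<in> \<C>)
        \<longrightarrow> (B, colim Q A (presheaf_cat Q B) p G) \<in> \<C>)"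

text \<open>
  The family of objects of type \<open>X\<close> is given by its set \<open>S\<close> of members, on which alone the
  supremum depends.
\<close>

definition conical ::
  "('o, 'm) quantaloid \<Rightarrow> ('o, 'm, 'a) qcat \<Rightarrow> ('o, 'm, 'a) presheaf \<Rightarrow> bool" where
  "conical Q A p \<longleftrightarrow>
     presheaf Q A p \<and>
     (\<exists>S \<subseteq> {a \<in> obj A. ty A a = fst p}.
        snd p = \<Squnion>\<^bsub>Dist Q (star Q (fst p)) A\<^esub> (rep_dist A ` S))"

definition conical_presheaves :: "('o, 'm) quantaloid \<Rightarrow> ('o, 'm, 'u) presheaf_class" where
  "conical_presheaves Q = {(A, p). qcategory Q A \<and> conical Q A p}"

end

theory Submission
  imports Defs
begin

text \<open>
  An arrow \<open>u\<close> lies below an entry of the lifting \<open>[\<Psi>,\<Phi>]\<close> iff \<open>\<Psi>(c,b) \<circ> u \<le> \<Phi>(c,a)\<close> for all \<open>c\<close>.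
  If \<open>\<phi>\<close> is the supremum of the \<open>A(-,s)\<close> with \<open>s \<in> S\<close>, the Yoneda lemma turns
  \<open>[\<phi>, P(B)(G-,\<psi>)]\<close> into the infimum of the \<open>P(B)(G s, \<psi>)\<close>, so that \<open>colim(\<phi>,G)\<close> is the
  elementwise supremum of the presheaves \<open>G s\<close>. When each \<open>G s\<close> is a supremum of representables, so
  is this colimit.
\<close>

text \<open>\<open>lifting\<close>, \<open>colim\<close> and the supremum in \<open>Dist\<close>
  merely select an object by a property, so each needs an explicit candidate and a uniqueness
  argument before it can be computed. For \<open>colim\<close> this shapes the end of the proof:
  conicality must be shown for the very object that \<open>SOME\<close> selects, not for an
  isomorphic one. This works because a presheaf is determined by its hom-arrows out of it in P(B).
  Hom-arrows are compared through the arrows u below them. Infima and residuals thereby become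
  universally quantified inequalities, and interchanging infima becomes exchanging
  quantifiers.\<close>

context quantaloid
begin

section \<open>Suprema and composition of arrows\<close>

abbreviation hom :: "'o \<Rightarrow> 'o \<Rightarrow> 'm set" where
  "hom X Y \<equiv> carrier (Hom Q X Y)"

lemma hom_partial_order: "\<lbrakk>X \<in> Obj Q; Y \<in> Obj Q\<rbrakk> \<Longrightarrow> partial_order (Hom Q X Y)"
  using hom_complete_lattice complete_lattice.axioms(1) by blast

lemma hom_refl: "\<lbrakk>X \<in> Obj Q; Y \<in> Obj Q; f \<in> hom X Y\<rbrakk> \<Longrightarrow> f \<sqsubseteq>\<^bsub>Hom Q X Y\<^esub> f"
  using hom_partial_order[of X Y] partial_order.axioms(1) weak_partial_order.le_refl by metis

lemma hom_trans:
  "\<lbrakk>f \<sqsubseteq>\<^bsub>Hom Q X Y\<^esub> g; g \<sqsubseteq>\<^bsub>Hom Q X Y\<^esub> h; X \<in> Obj Q; Y \<in> Obj Q;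
    f \<in> hom X Y; g \<in> hom X Y; h \<in> hom X Y\<rbrakk> \<Longrightarrow> f \<sqsubseteq>\<^bsub>Hom Q X Y\<^esub> h"
  using hom_partial_order[of X Y] partial_order.axioms(1) weak_partial_order.le_trans by metis

lemma hom_antisym:
  "\<lbrakk>f \<sqsubseteq>\<^bsub>Hom Q X Y\<^esub> g; g \<sqsubseteq>\<^bsub>Hom Q X Y\<^esub> f; X \<in> Obj Q; Y \<in> Obj Q; f \<in> hom X Y; g \<in> hom X Y\<rbrakk>
   \<Longrightarrow> f = g"
  using hom_partial_order[of X Y] partial_order.le_antisym by metis

lemma hom_weak_complete: "\<lbrakk>X \<in> Obj Q; Y \<in> Obj Q\<rbrakk> \<Longrightarrow> weak_complete_lattice (Hom Q X Y)"
proof -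
  assume "X \<in> Obj Q" "Y \<in> Obj Q"
  then interpret complete_lattice "Hom Q X Y" by (rule hom_complete_lattice)
  show ?thesis by unfold_locales
qed

lemma hom_sup_closed:
  "\<lbrakk>X \<in> Obj Q; Y \<in> Obj Q; S \<subseteq> hom X Y\<rbrakk> \<Longrightarrow> \<Squnion>\<^bsub>Hom Q X Y\<^esub> S \<in> hom X Y"
  using hom_weak_complete weak_complete_lattice.sup_closed by metis

lemma hom_sup_upper:
  "\<lbrakk>X \<in> Obj Q; Y \<in> Obj Q; S \<subseteq> hom X Y; f \<in> S\<rbrakk> \<Longrightarrow> f \<sqsubseteq>\<^bsub>Hom Q X Y\<^esub> \<Squnion>\<^bsub>Hom Q X Y\<^esub> S"
  using hom_weak_complete weak_complete_lattice.sup_upper by metis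

lemma hom_sup_least:
  "\<lbrakk>X \<in> Obj Q; Y \<in> Obj Q; S \<subseteq> hom X Y; g \<in> hom X Y; \<And>f. f \<in> S \<Longrightarrow> f \<sqsubseteq>\<^bsub>Hom Q X Y\<^esub> g\<rbrakk>
   \<Longrightarrow> \<Squnion>\<^bsub>Hom Q X Y\<^esub> S \<sqsubseteq>\<^bsub>Hom Q X Y\<^esub> g"
  using hom_weak_complete weak_complete_lattice.sup_least by metis

lemma hom_sup_le_iff:
  assumes "X \<in> Obj Q" "Y \<in> Obj Q" "S \<subseteq> hom X Y" "g \<in> hom X Y"
  shows "\<Squnion>\<^bsub>Hom Q X Y\<^esub> S \<sqsubseteq>\<^bsub>Hom Q X Y\<^esub> g \<longleftrightarrow> (\<forall>f\<in>S. f \<sqsubseteq>\<^bsub>Hom Q X Y\<^esub> g)"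
proof
  assume *: "\<Squnion>\<^bsub>Hom Q X Y\<^esub> S \<sqsubseteq>\<^bsub>Hom Q X Y\<^esub> g"
  show "\<forall>f\<in>S. f \<sqsubseteq>\<^bsub>Hom Q X Y\<^esub> g"
  proof
    fix f assume f: "f \<in> S"
    show "f \<sqsubseteq>\<^bsub>Hom Q X Y\<^esub> g"
      using hom_trans[OF hom_sup_upper[OF assms(1-3) f] *] assms f hom_sup_closed by blast
  qed
qed (use assms hom_sup_least in blast)

text \<open>Testing with u = f and u = g gives both inequalities. It recovers an equation from
  universal properties such as that of the lifting, which only describe the arrows below.\<close>

lemma hom_eqI:
  assumes "X \<in> Obj Q" "Y \<in> Obj Q" "f \<in> hom X Y" "g \<in> hom X Y"
    and "\<And>u. u \<in> hom X Y \<Longrightarrow> u \<sqsubseteq>\<^bsub>Hom Q X Y\<^esub> f \<longleftrightarrow> u \<sqsubseteq>\<^bsub>Hom Q X Y\<^esub> g"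
  shows "f = g"
  using assms hom_antisym hom_refl by blast

text \<open>Both sides have the same upper bounds g; taking for g each of the two suprema gives the
  two inequalities. Empty S or empty \<open>F s\<close> need no special treatment.\<close>

lemma hom_sup_UN:
  assumes "X \<in> Obj Q" "Y \<in> Obj Q" and F: "\<And>s. s \<in> S \<Longrightarrow> F s \<subseteq> hom X Y"
  shows "\<Squnion>\<^bsub>Hom Q X Y\<^esub> ((\<lambda>s. \<Squnion>\<^bsub>Hom Q X Y\<^esub> (F s)) ` S) = \<Squnion>\<^bsub>Hom Q X Y\<^esub> (\<Union>s\<in>S. F s)"
proof -
  have inner: "(\<lambda>s. \<Squnion>\<^bsub>Hom Q X Y\<^esub> (F s)) ` S \<subseteq> hom X Y" and union: "(\<Union>s\<in>S. F s) \<subseteq> hom X Y"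
    using assms hom_sup_closed by auto
  note closed = hom_sup_closed[OF assms(1,2) inner] hom_sup_closed[OF assms(1,2) union]
  have le_iff: "\<Squnion>\<^bsub>Hom Q X Y\<^esub> ((\<lambda>s. \<Squnion>\<^bsub>Hom Q X Y\<^esub> (F s)) ` S) \<sqsubseteq>\<^bsub>Hom Q X Y\<^esub> g \<longleftrightarrow>
      \<Squnion>\<^bsub>Hom Q X Y\<^esub> (\<Union>s\<in>S. F s) \<sqsubseteq>\<^bsub>Hom Q X Y\<^esub> g" if g: "g \<in> hom X Y" for g
    using hom_sup_le_iff[OF assms(1,2) inner g] hom_sup_le_iff[OF assms(1,2) union g]
      hom_sup_le_iff[OF assms(1,2) F g] by auto
  show ?thesis
    using le_iff[OF closed(1)] le_iff[OF closed(2)] closed hom_refl[OF assms(1,2)]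
    by (intro hom_antisym[OF _ _ assms(1,2)]) simp_all
qed

text \<open>It expresses the order as an equation between suprema, the form in which the quantaloid
  axioms can be applied to it.\<close>

lemma hom_sup_pair:
  assumes "X \<in> Obj Q" "Y \<in> Obj Q" "f \<in> hom X Y" "g \<in> hom X Y" "f \<sqsubseteq>\<^bsub>Hom Q X Y\<^esub> g"
  shows "\<Squnion>\<^bsub>Hom Q X Y\<^esub> {f, g} = g"
proof (rule hom_antisym[where X = X and Y = Y])
  show "\<Squnion>\<^bsub>Hom Q X Y\<^esub> {f, g} \<sqsubseteq>\<^bsub>Hom Q X Y\<^esub> g"
    using assms hom_refl by (intro hom_sup_least) auto
qed (use assms hom_sup_closed hom_sup_upper in auto)

text \<open>Monotonicity is not an axiom here. It follows from preservation of the supremum of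
  \<open>{f, f'}\<close>, which equals f'.\<close>

lemma cmp_mono_right:
  assumes "X \<in> Obj Q" "Y \<in> Obj Q" "Z \<in> Obj Q" "f \<in> hom X Y" "f' \<in> hom X Y" "g \<in> hom Y Z"
    and le: "f \<sqsubseteq>\<^bsub>Hom Q X Y\<^esub> f'"
  shows "g \<cdot> f \<sqsubseteq>\<^bsub>Hom Q X Z\<^esub> g \<cdot> f'"
proof -
  have "g \<cdot> f' = \<Squnion>\<^bsub>Hom Q X Z\<^esub> {g \<cdot> f, g \<cdot> f'}"
    using cmp_sup_right[of X Y Z "{f, f'}" g] hom_sup_pair[of X Y f f'] assms by simp
  then show ?thesis
    using hom_sup_upper[of X Z "{g \<cdot> f, g \<cdot> f'}" "g \<cdot> f"] assms
      cmp_closed[of X Y Z f g] cmp_closed[of X Y Z f' g] by simp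
qed

lemma cmp_mono_left:
  assumes "X \<in> Obj Q" "Y \<in> Obj Q" "Z \<in> Obj Q" "f \<in> hom X Y" "g \<in> hom Y Z" "g' \<in> hom Y Z"
    and le: "g \<sqsubseteq>\<^bsub>Hom Q Y Z\<^esub> g'"
  shows "g \<cdot> f \<sqsubseteq>\<^bsub>Hom Q X Z\<^esub> g' \<cdot> f"
proof -
  have "g' \<cdot> f = \<Squnion>\<^bsub>Hom Q X Z\<^esub> {g \<cdot> f, g' \<cdot> f}"
    using cmp_sup_left[of X Y Z f "{g, g'}"] hom_sup_pair[of Y Z g g'] assms by simp
  then show ?thesis
    using hom_sup_upper[of X Z "{g \<cdot> f, g' \<cdot> f}" "g \<cdot> f"] assms
      cmp_closed[of X Y Z f g] cmp_closed[of X Y Z f g'] by simp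
qed

text \<open>This side serves the liftings, where the supremum is in the right factor. The version
  for the left factor serves weights and presheaves that are themselves suprema.\<close>

lemma cmp_sup_right_le_iff:
  assumes "X \<in> Obj Q" "Y \<in> Obj Q" "Z \<in> Obj Q" "S \<subseteq> hom X Y" "g \<in> hom Y Z" "h \<in> hom X Z"
  shows "g \<cdot> (\<Squnion>\<^bsub>Hom Q X Y\<^esub> S) \<sqsubseteq>\<^bsub>Hom Q X Z\<^esub> h \<longleftrightarrow> (\<forall>f\<in>S. g \<cdot> f \<sqsubseteq>\<^bsub>Hom Q X Z\<^esub> h)"
proof -
  have "(\<lambda>f. g \<cdot> f) ` S \<subseteq> hom X Z"
    using assms cmp_closed by blast
  then show ?thesis
    using assms by (simp add: cmp_sup_right[of X Y Z] hom_sup_le_iff)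
qed

lemma cmp_sup_left_le_iff:
  assumes "X \<in> Obj Q" "Y \<in> Obj Q" "Z \<in> Obj Q" "S \<subseteq> hom Y Z" "f \<in> hom X Y" "h \<in> hom X Z"
  shows "(\<Squnion>\<^bsub>Hom Q Y Z\<^esub> S) \<cdot> f \<sqsubseteq>\<^bsub>Hom Q X Z\<^esub> h \<longleftrightarrow> (\<forall>g\<in>S. g \<cdot> f \<sqsubseteq>\<^bsub>Hom Q X Z\<^esub> h)"
proof -
  have "(\<lambda>g. g \<cdot> f) ` S \<subseteq> hom X Z"
    using assms cmp_closed by blast
  then show ?thesis
    using assms by (simp add: cmp_sup_left[of X Y Z] hom_sup_le_iff)
qed


section \<open>Distributors and liftings\<close>

lemma ty_Obj: "\<lbrakk>qcategory Q A; a \<in> obj A\<rbrakk> \<Longrightarrow> ty A a \<in> Obj Q"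
  by (auto simp: qcategory_def)

lemma arr_hom:
  "\<lbrakk>qcategory Q A; a' \<in> obj A; a \<in> obj A\<rbrakk> \<Longrightarrow> arr A a' a \<in> hom (ty A a) (ty A a')"
  by (auto simp: qcategory_def)

lemma arr_image_hom:
  assumes A: "qcategory Q A" and a: "a \<in> obj A" and S: "S \<subseteq> {a \<in> obj A. ty A a = X}"
  shows "arr A a ` S \<subseteq> hom X (ty A a)"
proof clarify
  fix s assume "s \<in> S"
  then have "s \<in> obj A" "ty A s = X" using S by auto
  then show "arr A a s \<in> hom X (ty A a)" using arr_hom[OF A a, of s] by simp
qed

lemma idn_le_arr:
  "\<lbrakk>qcategory Q A; a \<in> obj A\<rbrakk> \<Longrightarrow> idn Q (ty A a) \<sqsubseteq>\<^bsub>Hom Q (ty A a) (ty A a)\<^esub> arr A a a"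
  by (auto simp: qcategory_def)

lemma arr_cmp_le:
  "\<lbrakk>qcategory Q A; a'' \<in> obj A; a' \<in> obj A; a \<in> obj A\<rbrakk>
   \<Longrightarrow> arr A a'' a' \<cdot> arr A a' a \<sqsubseteq>\<^bsub>Hom Q (ty A a) (ty A a'')\<^esub> arr A a'' a"
  by (auto simp: qcategory_def)

lemma star_simps: "obj (star Q X) = UNIV" "ty (star Q X) a = X" "arr (star Q X) a' a = idn Q X"
  by (simp_all add: star_def)

lemma star_qcategory: "X \<in> Obj Q \<Longrightarrow> qcategory Q (star Q X)"
  by (auto simp: qcategory_def star_simps idn_closed idn_left hom_refl)

lemma mat_apply: "\<lbrakk>b \<in> I; a \<in> J\<rbrakk> \<Longrightarrow> mat I J f b a = f b a"
  by (simp add: mat_def)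

lemma mat_mat: "mat I J (mat I J f) = mat I J f"
  by (auto simp: mat_def fun_eq_iff)

lemma dist_hom:
  "\<lbrakk>distributor Q A B \<Phi>; b \<in> obj B; a \<in> obj A\<rbrakk> \<Longrightarrow> \<Phi> b a \<in> hom (ty A a) (ty B b)"
  unfolding distributor_def by blast

lemma dist_cmp_right:
  "\<lbrakk>distributor Q A B \<Phi>; b \<in> obj B; a' \<in> obj A; a \<in> obj A\<rbrakk>
   \<Longrightarrow> \<Phi> b a' \<cdot> arr A a' a \<sqsubseteq>\<^bsub>Hom Q (ty A a) (ty B b)\<^esub> \<Phi> b a"
  unfolding distributor_def by blast

lemma dist_cmp_left:
  "\<lbrakk>distributor Q A B \<Phi>; b \<in> obj B; b' \<in> obj B; a \<in> obj A\<rbrakk>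
   \<Longrightarrow> arr B b b' \<cdot> \<Phi> b' a \<sqsubseteq>\<^bsub>Hom Q (ty A a) (ty B b)\<^esub> \<Phi> b a"
  unfolding distributor_def by blast

text \<open>Off the index sets both matrices are \<open>undefined\<close> by the normalisation
  clause, so the entries decide.\<close>

lemma dist_eqI:
  assumes "distributor Q A B \<Phi>" "distributor Q A B \<Psi>"
    and eq: "\<And>b a. \<lbrakk>b \<in> obj B; a \<in> obj A\<rbrakk> \<Longrightarrow> \<Phi> b a = \<Psi> b a"
  shows "\<Phi> = \<Psi>"
proof -
  have "\<Phi> = mat (obj B) (obj A) \<Phi>" "\<Psi> = mat (obj B) (obj A) \<Psi>"
    using assms(1,2) unfolding distributor_def by blast+
  moreover have "mat (obj B) (obj A) \<Phi> = mat (obj B) (obj A) \<Psi>"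
    using eq by (auto simp: mat_def fun_eq_iff)
  ultimately show ?thesis by metis
qed

lemma dist_matI:
  assumes "\<And>b a. \<lbrakk>b \<in> obj B; a \<in> obj A\<rbrakk> \<Longrightarrow> f b a \<in> hom (ty A a) (ty B b)"
    and "\<And>b a' a. \<lbrakk>b \<in> obj B; a' \<in> obj A; a \<in> obj A\<rbrakk>
          \<Longrightarrow> f b a' \<cdot> arr A a' a \<sqsubseteq>\<^bsub>Hom Q (ty A a) (ty B b)\<^esub> f b a"
    and "\<And>b b' a. \<lbrakk>b \<in> obj B; b' \<in> obj B; a \<in> obj A\<rbrakk>
          \<Longrightarrow> arr B b b' \<cdot> f b' a \<sqsubseteq>\<^bsub>Hom Q (ty A a) (ty B b)\<^esub> f b a"
  shows "distributor Q A B (mat (obj B) (obj A) f)"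
  using assms by (simp add: distributor_def mat_mat mat_apply)

section \<open>The order on distributors and its elementwise suprema\<close>

text \<open>Antisymmetry makes greatest and least elements unique, which is what allows the selected
  supremum and the selected lifting to be identified with explicit matrices.\<close>

lemma Dist_partial_order:
  assumes A: "qcategory Q A" and B: "qcategory Q B"
  shows "partial_order (Dist Q A B)"
proof -
  have refl: "\<Phi> b a \<sqsubseteq>\<^bsub>Hom Q (ty A a) (ty B b)\<^esub> \<Phi> b a"
    if "distributor Q A B \<Phi>" "b \<in> obj B" "a \<in> obj A" for \<Phi> b a
    using hom_refl ty_Obj[OF A that(3)] ty_Obj[OF B that(2)] dist_hom[OF that] by simp
  have trans: "\<Phi> b a \<sqsubseteq>\<^bsub>Hom Q (ty A a) (ty B b)\<^esub> \<Theta> b a"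
    if "distributor Q A B \<Phi>" "distributor Q A B \<Psi>" "distributor Q A B \<Theta>" "b \<in> obj B" "a \<in> obj A"
      "\<forall>b\<in>obj B. \<forall>a\<in>obj A. \<Phi> b a \<sqsubseteq>\<^bsub>Hom Q (ty A a) (ty B b)\<^esub> \<Psi> b a"
      "\<forall>b\<in>obj B. \<forall>a\<in>obj A. \<Psi> b a \<sqsubseteq>\<^bsub>Hom Q (ty A a) (ty B b)\<^esub> \<Theta> b a" for \<Phi> \<Psi> \<Theta> b a
    using that ty_Obj[OF A] ty_Obj[OF B] dist_hom[OF that(1)] dist_hom[OF that(2)] dist_hom[OF that(3)]
    by (intro hom_trans[of "ty A a" "ty B b" "\<Phi> b a" "\<Psi> b a" "\<Theta> b a"]) auto
  have antisym: "\<Phi> = \<Psi>"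
    if "distributor Q A B \<Phi>" "distributor Q A B \<Psi>"
      "\<forall>b\<in>obj B. \<forall>a\<in>obj A. \<Phi> b a \<sqsubseteq>\<^bsub>Hom Q (ty A a) (ty B b)\<^esub> \<Psi> b a"
      "\<forall>b\<in>obj B. \<forall>a\<in>obj A. \<Psi> b a \<sqsubseteq>\<^bsub>Hom Q (ty A a) (ty B b)\<^esub> \<Phi> b a" for \<Phi> \<Psi>
  proof (rule dist_eqI[OF that(1,2)])
    fix b a assume "b \<in> obj B" "a \<in> obj A"
    then show "\<Phi> b a = \<Psi> b a"
      using that ty_Obj[OF A] ty_Obj[OF B] dist_hom[OF that(1)] dist_hom[OF that(2)]
      by (intro hom_antisym[of "ty A a" "ty B b" "\<Phi> b a" "\<Psi> b a"]) auto
  qed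
  show ?thesis
  proof
    fix \<Phi> \<Psi> \<Theta>
    assume "\<Phi> \<sqsubseteq>\<^bsub>Dist Q A B\<^esub> \<Psi>" "\<Psi> \<sqsubseteq>\<^bsub>Dist Q A B\<^esub> \<Theta>"
      "\<Phi> \<in> carrier (Dist Q A B)" "\<Psi> \<in> carrier (Dist Q A B)" "\<Theta> \<in> carrier (Dist Q A B)"
    then show "\<Phi> \<sqsubseteq>\<^bsub>Dist Q A B\<^esub> \<Theta>"
      using trans[of \<Phi> \<Psi> \<Theta>] by (simp add: Dist_def)
  qed (auto simp: Dist_def refl intro: antisym)
qed

text \<open>Composition with a hom-arrow of A or B distributes over the supremum in each entry, so
  the action laws follow from those of the members of S.\<close>

lemma dist_sup:
  assumes A: "qcategory Q A" and B: "qcategory Q B" and S: "\<And>\<Phi>. \<Phi> \<in> S \<Longrightarrow> distributor Q A B \<Phi>"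
  shows "distributor Q A B
    (mat (obj B) (obj A) (\<lambda>b a. \<Squnion>\<^bsub>Hom Q (ty A a) (ty B b)\<^esub> ((\<lambda>\<Phi>. \<Phi> b a) ` S)))"
proof -
  have sub: "(\<lambda>\<Phi>. \<Phi> b a) ` S \<subseteq> hom (ty A a) (ty B b)" if "b \<in> obj B" "a \<in> obj A" for b a
    using that dist_hom[OF S] by auto
  note o = ty_Obj[OF A] ty_Obj[OF B]
  show ?thesis
  proof (rule dist_matI)
    fix b a assume ba: "b \<in> obj B" "a \<in> obj A"
    let ?s = "\<lambda>b a. \<Squnion>\<^bsub>Hom Q (ty A a) (ty B b)\<^esub> ((\<lambda>\<Phi>. \<Phi> b a) ` S)"
    show s: "?s b a \<in> hom (ty A a) (ty B b)"
      using ba o sub by (intro hom_sup_closed) auto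
    have up: "\<Phi> b a \<sqsubseteq>\<^bsub>Hom Q (ty A a) (ty B b)\<^esub> ?s b a" if "\<Phi> \<in> S" for \<Phi>
      using that ba o sub by (intro hom_sup_upper) auto
    show "?s b a' \<cdot> arr A a' a \<sqsubseteq>\<^bsub>Hom Q (ty A a) (ty B b)\<^esub> ?s b a" if a': "a' \<in> obj A" for a'
    proof (subst cmp_sup_left_le_iff)
      show "\<forall>g\<in>(\<lambda>\<Phi>. \<Phi> b a') ` S. g \<cdot> arr A a' a \<sqsubseteq>\<^bsub>Hom Q (ty A a) (ty B b)\<^esub> ?s b a"
      proof clarify
        fix \<Phi> assume \<Phi>: "\<Phi> \<in> S"
        show "\<Phi> b a' \<cdot> arr A a' a \<sqsubseteq>\<^bsub>Hom Q (ty A a) (ty B b)\<^esub> ?s b a"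
          by (rule hom_trans[OF dist_cmp_right[OF S[OF \<Phi>]] up[OF \<Phi>]])
            (use ba a' o s arr_hom[OF A] dist_hom[OF S[OF \<Phi>]] cmp_closed in metis)+
      qed
    qed (use ba a' o sub s arr_hom[OF A] in auto)
    show "arr B b b' \<cdot> ?s b' a \<sqsubseteq>\<^bsub>Hom Q (ty A a) (ty B b)\<^esub> ?s b a" if b': "b' \<in> obj B" for b'
    proof (subst cmp_sup_right_le_iff)
      show "\<forall>g\<in>(\<lambda>\<Phi>. \<Phi> b' a) ` S. arr B b b' \<cdot> g \<sqsubseteq>\<^bsub>Hom Q (ty A a) (ty B b)\<^esub> ?s b a"
      proof clarify
        fix \<Phi> assume \<Phi>: "\<Phi> \<in> S"
        show "arr B b b' \<cdot> \<Phi> b' a \<sqsubseteq>\<^bsub>Hom Q (ty A a) (ty B b)\<^esub> ?s b a"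
          by (rule hom_trans[OF dist_cmp_left[OF S[OF \<Phi>]] up[OF \<Phi>]])
            (use ba b' o s arr_hom[OF B] dist_hom[OF S[OF \<Phi>]] cmp_closed in metis)+
      qed
    qed (use ba b' o sub s arr_hom[OF B] in auto)
  qed
qed

lemma Dist_sup:
  assumes A: "qcategory Q A" and B: "qcategory Q B" and S: "\<And>\<Phi>. \<Phi> \<in> S \<Longrightarrow> distributor Q A B \<Phi>"
  shows "\<Squnion>\<^bsub>Dist Q A B\<^esub> S =
    mat (obj B) (obj A) (\<lambda>b a. \<Squnion>\<^bsub>Hom Q (ty A a) (ty B b)\<^esub> ((\<lambda>\<Phi>. \<Phi> b a) ` S))"
    (is "_ = ?M")
proof -
  have sub: "(\<lambda>\<Phi>. \<Phi> b a) ` S \<subseteq> hom (ty A a) (ty B b)" if "b \<in> obj B" "a \<in> obj A" for b a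
    using that dist_hom[OF S] by auto
  have "least (Dist Q A B) ?M (Upper (Dist Q A B) S)"
  proof (rule least_UpperI)
    show "\<Phi> \<sqsubseteq>\<^bsub>Dist Q A B\<^esub> ?M" if "\<Phi> \<in> S" for \<Phi>
      using that dist_hom[OF S] ty_Obj[OF A] ty_Obj[OF B]
      by (auto simp: Dist_def mat_apply intro!: hom_sup_upper)
    show "?M \<sqsubseteq>\<^bsub>Dist Q A B\<^esub> \<Psi>" if "\<Psi> \<in> Upper (Dist Q A B) S" for \<Psi>
    proof -
      have \<Psi>: "distributor Q A B \<Psi>"
        and le: "\<And>\<Phi> b a. \<lbrakk>\<Phi> \<in> S; b \<in> obj B; a \<in> obj A\<rbrakk>
                  \<Longrightarrow> \<Phi> b a \<sqsubseteq>\<^bsub>Hom Q (ty A a) (ty B b)\<^esub> \<Psi> b a"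
        using that S by (auto simp: Upper_def Dist_def)
      have "\<Squnion>\<^bsub>Hom Q (ty A a) (ty B b)\<^esub> ((\<lambda>\<Phi>. \<Phi> b a) ` S) \<sqsubseteq>\<^bsub>Hom Q (ty A a) (ty B b)\<^esub> \<Psi> b a"
        if "b \<in> obj B" "a \<in> obj A" for b a
        using that sub le dist_hom[OF \<Psi>] ty_Obj[OF A] ty_Obj[OF B]
        by (intro hom_sup_least) auto
      then show ?thesis by (simp add: Dist_def mat_apply)
    qed
    show "S \<subseteq> carrier (Dist Q A B)" using S by (auto simp: Dist_def)
    show "?M \<in> carrier (Dist Q A B)" using dist_sup[OF A B S] by (simp add: Dist_def)
  qed
  then show ?thesis
    unfolding sup_def
    using partial_order.least_unique[OF Dist_partial_order[OF A B]] by blast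
qed

section \<open>An explicit formula for liftings\<close>

text \<open>The entry at (b,a) is the infimum over c of the residuals of \<open>\<Phi> c a\<close>
  along \<open>\<Psi> c b\<close>, written as the supremum of all arrows admissible for every c at
  once.\<close>

definition pointwise_lifting ::
  "('o, 'm, 'x) qcat \<Rightarrow> ('o, 'm, 'y) qcat \<Rightarrow> ('o, 'm, 'z) qcat \<Rightarrow>
   ('z \<Rightarrow> 'y \<Rightarrow> 'm) \<Rightarrow> ('z \<Rightarrow> 'x \<Rightarrow> 'm) \<Rightarrow> 'y \<Rightarrow> 'x \<Rightarrow> 'm" where
  "pointwise_lifting A B C \<Psi> \<Phi> = mat (obj B) (obj A) (\<lambda>b a. \<Squnion>\<^bsub>Hom Q (ty A a) (ty B b)\<^esub>
     {u \<in> hom (ty A a) (ty B b). \<forall>c\<in>obj C. \<Psi> c b \<cdot> u \<sqsubseteq>\<^bsub>Hom Q (ty A a) (ty C c)\<^esub> \<Phi> c a})"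

context
  fixes A :: "('o, 'm, 'x) qcat" and B :: "('o, 'm, 'y) qcat" and C :: "('o, 'm, 'z) qcat"
    and \<Phi> :: "'z \<Rightarrow> 'x \<Rightarrow> 'm" and \<Psi> :: "'z \<Rightarrow> 'y \<Rightarrow> 'm"
  assumes A: "qcategory Q A" and B: "qcategory Q B" and C: "qcategory Q C"
    and \<Phi>: "distributor Q A C \<Phi>" and \<Psi>: "distributor Q B C \<Psi>"
begin

lemmas lifting_typing =
  ty_Obj[OF A] ty_Obj[OF B] ty_Obj[OF C] dist_hom[OF \<Phi>] dist_hom[OF \<Psi>] arr_hom[OF A] arr_hom[OF B]

lemma pointwise_lifting_hom:
  "\<lbrakk>b \<in> obj B; a \<in> obj A\<rbrakk> \<Longrightarrow> pointwise_lifting A B C \<Psi> \<Phi> b a \<in> hom (ty A a) (ty B b)"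
  using lifting_typing by (auto simp: pointwise_lifting_def mat_apply intro!: hom_sup_closed)

text \<open>The supremum of the admissible arrows is itself admissible, because composition with
  \<open>\<Psi> c b\<close> preserves suprema.\<close>

lemma cmp_pointwise_lifting_le:
  assumes "b \<in> obj B" "a \<in> obj A" "c \<in> obj C"
  shows "\<Psi> c b \<cdot> pointwise_lifting A B C \<Psi> \<Phi> b a \<sqsubseteq>\<^bsub>Hom Q (ty A a) (ty C c)\<^esub> \<Phi> c a"
  using assms lifting_typing
  by (auto simp: pointwise_lifting_def mat_apply cmp_sup_right_le_iff)

text \<open>This is the adjunction between composing and lifting, localised at one entry: u is a
  single arrow and need not come from a distributor.\<close>

lemma le_pointwise_lifting_iff:
  assumes ba: "b \<in> obj B" "a \<in> obj A" and u: "u \<in> hom (ty A a) (ty B b)"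
  shows "u \<sqsubseteq>\<^bsub>Hom Q (ty A a) (ty B b)\<^esub> pointwise_lifting A B C \<Psi> \<Phi> b a \<longleftrightarrow>
    (\<forall>c\<in>obj C. \<Psi> c b \<cdot> u \<sqsubseteq>\<^bsub>Hom Q (ty A a) (ty C c)\<^esub> \<Phi> c a)"
proof
  assume le: "u \<sqsubseteq>\<^bsub>Hom Q (ty A a) (ty B b)\<^esub> pointwise_lifting A B C \<Psi> \<Phi> b a"
  show "\<forall>c\<in>obj C. \<Psi> c b \<cdot> u \<sqsubseteq>\<^bsub>Hom Q (ty A a) (ty C c)\<^esub> \<Phi> c a"
  proof
    fix c assume c: "c \<in> obj C"
    show "\<Psi> c b \<cdot> u \<sqsubseteq>\<^bsub>Hom Q (ty A a) (ty C c)\<^esub> \<Phi> c a"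
      by (rule hom_trans[OF cmp_mono_right[OF _ _ _ _ _ _ le] cmp_pointwise_lifting_le])
        (use ba u c lifting_typing pointwise_lifting_hom cmp_closed in metis)+
  qed
next
  assume "\<forall>c\<in>obj C. \<Psi> c b \<cdot> u \<sqsubseteq>\<^bsub>Hom Q (ty A a) (ty C c)\<^esub> \<Phi> c a"
  then show "u \<sqsubseteq>\<^bsub>Hom Q (ty A a) (ty B b)\<^esub> pointwise_lifting A B C \<Psi> \<Phi> b a"
    using ba u lifting_typing
    by (auto simp: pointwise_lifting_def mat_apply intro!: hom_sup_upper)
qed

text \<open>By the adjunction and associativity, each action law reduces to one for the data: the
  action of A is absorbed by \<Phi> after lifting has been cancelled, the action of B is absorbed by
  \<Psi> before it is cancelled.\<close>

lemma pointwise_lifting_dist: "distributor Q A B (pointwise_lifting A B C \<Psi> \<Phi>)"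
proof -
  let ?L = "pointwise_lifting A B C \<Psi> \<Phi>"
  have "distributor Q A B (mat (obj B) (obj A) ?L)"
  proof (rule dist_matI)
    fix b a assume ba: "b \<in> obj B" "a \<in> obj A"
    show "?L b a \<in> hom (ty A a) (ty B b)" using pointwise_lifting_hom[OF ba] .
    show "?L b a' \<cdot> arr A a' a \<sqsubseteq>\<^bsub>Hom Q (ty A a) (ty B b)\<^esub> ?L b a" if a': "a' \<in> obj A" for a'
    proof (subst le_pointwise_lifting_iff[OF ba])
      show "?L b a' \<cdot> arr A a' a \<in> hom (ty A a) (ty B b)"
        using ba a' lifting_typing pointwise_lifting_hom cmp_closed by metis
      show "\<forall>c\<in>obj C. \<Psi> c b \<cdot> (?L b a' \<cdot> arr A a' a) \<sqsubseteq>\<^bsub>Hom Q (ty A a) (ty C c)\<^esub> \<Phi> c a"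
      proof
        fix c assume c: "c \<in> obj C"
        have "\<Psi> c b \<cdot> (?L b a' \<cdot> arr A a' a) = (\<Psi> c b \<cdot> ?L b a') \<cdot> arr A a' a"
          using ba a' c lifting_typing pointwise_lifting_hom
          by (intro cmp_assoc[symmetric, of "ty A a" "ty A a'" "ty B b" "ty C c"]) auto
        moreover have "(\<Psi> c b \<cdot> ?L b a') \<cdot> arr A a' a \<sqsubseteq>\<^bsub>Hom Q (ty A a) (ty C c)\<^esub> \<Phi> c a"
          by (rule hom_trans[OF cmp_mono_left[OF _ _ _ _ _ _ cmp_pointwise_lifting_le]
                dist_cmp_right[OF \<Phi>]])
            (use ba a' c lifting_typing pointwise_lifting_hom cmp_closed in metis)+
        ultimately show "\<Psi> c b \<cdot> (?L b a' \<cdot> arr A a' a) \<sqsubseteq>\<^bsub>Hom Q (ty A a) (ty C c)\<^esub> \<Phi> c a"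
          by simp
      qed
    qed
    show "arr B b b' \<cdot> ?L b' a \<sqsubseteq>\<^bsub>Hom Q (ty A a) (ty B b)\<^esub> ?L b a" if b': "b' \<in> obj B" for b'
    proof (subst le_pointwise_lifting_iff[OF ba])
      show "arr B b b' \<cdot> ?L b' a \<in> hom (ty A a) (ty B b)"
        using ba b' lifting_typing pointwise_lifting_hom cmp_closed by metis
      show "\<forall>c\<in>obj C. \<Psi> c b \<cdot> (arr B b b' \<cdot> ?L b' a) \<sqsubseteq>\<^bsub>Hom Q (ty A a) (ty C c)\<^esub> \<Phi> c a"
      proof
        fix c assume c: "c \<in> obj C"
        have "\<Psi> c b \<cdot> (arr B b b' \<cdot> ?L b' a) = (\<Psi> c b \<cdot> arr B b b') \<cdot> ?L b' a"
          using ba b' c lifting_typing pointwise_lifting_hom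
          by (intro cmp_assoc[symmetric, of "ty A a" "ty B b'" "ty B b" "ty C c"]) auto
        moreover have "(\<Psi> c b \<cdot> arr B b b') \<cdot> ?L b' a \<sqsubseteq>\<^bsub>Hom Q (ty A a) (ty C c)\<^esub> \<Phi> c a"
          by (rule hom_trans[OF cmp_mono_left[OF _ _ _ _ _ _ dist_cmp_right[OF \<Psi>]]
                cmp_pointwise_lifting_le])
            (use ba b' c lifting_typing pointwise_lifting_hom cmp_closed in metis)+
        ultimately show "\<Psi> c b \<cdot> (arr B b b' \<cdot> ?L b' a) \<sqsubseteq>\<^bsub>Hom Q (ty A a) (ty C c)\<^esub> \<Phi> c a"
          by simp
      qed
    qed
  qed
  then show ?thesis
    by (simp add: pointwise_lifting_def mat_mat)
qed

text \<open>Removing the supremum over b leaves exactly the admissibility condition of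
  \<open>pointwise_lifting\<close>, imposed on every entry of \<Theta>.\<close>

lemma tensor_le_iff:
  assumes \<Theta>: "distributor Q A B \<Theta>"
  shows "tensor Q A B C \<Psi> \<Theta> \<sqsubseteq>\<^bsub>Dist Q A C\<^esub> \<Phi> \<longleftrightarrow>
    (\<forall>b\<in>obj B. \<forall>a\<in>obj A. \<forall>c\<in>obj C. \<Psi> c b \<cdot> \<Theta> b a \<sqsubseteq>\<^bsub>Hom Q (ty A a) (ty C c)\<^esub> \<Phi> c a)"
proof -
  have "\<Squnion>\<^bsub>Hom Q (ty A a) (ty C c)\<^esub> ((\<lambda>b. \<Psi> c b \<cdot> \<Theta> b a) ` obj B)
      \<sqsubseteq>\<^bsub>Hom Q (ty A a) (ty C c)\<^esub> \<Phi> c a \<longleftrightarrow>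
    (\<forall>b\<in>obj B. \<Psi> c b \<cdot> \<Theta> b a \<sqsubseteq>\<^bsub>Hom Q (ty A a) (ty C c)\<^esub> \<Phi> c a)"
    if "c \<in> obj C" "a \<in> obj A" for c a
  proof (subst hom_sup_le_iff)
    show "(\<lambda>b. \<Psi> c b \<cdot> \<Theta> b a) ` obj B \<subseteq> hom (ty A a) (ty C c)"
      using that lifting_typing dist_hom[OF \<Theta>] by (auto intro!: cmp_closed[of "ty A a" "ty B _"])
  qed (use that lifting_typing in auto)
  then show ?thesis
    by (auto simp: Dist_def tensor_def mat_apply)
qed

lemma lifting_eq_pointwise: "lifting Q A B C \<Psi> \<Phi> = pointwise_lifting A B C \<Psi> \<Phi>"
proof -
  let ?S = "{\<Theta> \<in> carrier (Dist Q A B). tensor Q A B C \<Psi> \<Theta> \<sqsubseteq>\<^bsub>Dist Q A C\<^esub> \<Phi>}"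
  have "greatest (Dist Q A B) (pointwise_lifting A B C \<Psi> \<Phi>) ?S"
    unfolding greatest_def
  proof (intro conjI ballI)
    show "pointwise_lifting A B C \<Psi> \<Phi> \<in> ?S"
      using pointwise_lifting_dist tensor_le_iff cmp_pointwise_lifting_le by (simp add: Dist_def)
    fix \<Theta> assume "\<Theta> \<in> ?S"
    then have \<Theta>: "distributor Q A B \<Theta>" and le: "tensor Q A B C \<Psi> \<Theta> \<sqsubseteq>\<^bsub>Dist Q A C\<^esub> \<Phi>"
      by (simp_all add: Dist_def)
    show "\<Theta> \<sqsubseteq>\<^bsub>Dist Q A B\<^esub> pointwise_lifting A B C \<Psi> \<Phi>"
      using le dist_hom[OF \<Theta>] le_pointwise_lifting_iff
      unfolding tensor_le_iff[OF \<Theta>] by (simp add: Dist_def)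
  qed (auto simp: Dist_def)
  then show ?thesis
    unfolding lifting_def
    using partial_order.greatest_unique[OF Dist_partial_order[OF A B]] by blast
qed

lemma lifting_dist: "distributor Q A B (lifting Q A B C \<Psi> \<Phi>)"
  using pointwise_lifting_dist by (simp add: lifting_eq_pointwise)

text \<open>Together with \<open>lifting_dist\<close> this is all that the rest of the proof uses
  about liftings.\<close>

lemma le_lifting_iff:
  "\<lbrakk>b \<in> obj B; a \<in> obj A; u \<in> hom (ty A a) (ty B b)\<rbrakk>
   \<Longrightarrow> u \<sqsubseteq>\<^bsub>Hom Q (ty A a) (ty B b)\<^esub> lifting Q A B C \<Psi> \<Phi> b a \<longleftrightarrow>
    (\<forall>c\<in>obj C. \<Psi> c b \<cdot> u \<sqsubseteq>\<^bsub>Hom Q (ty A a) (ty C c)\<^esub> \<Phi> c a)"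
  using le_pointwise_lifting_iff by (simp add: lifting_eq_pointwise)

end

section \<open>Presheaves and conical colimits\<close>

lemma presheaf_Obj: "presheaf Q A p \<Longrightarrow> fst p \<in> Obj Q"
  by (simp add: presheaf_def)

lemma presheaf_dist: "presheaf Q A p \<Longrightarrow> distributor Q (star Q (fst p)) A (snd p)"
  by (simp add: presheaf_def Dist_def)

lemma presheaf_hom: "\<lbrakk>presheaf Q A p; a \<in> obj A\<rbrakk> \<Longrightarrow> snd p a () \<in> hom (fst p) (ty A a)"
  using dist_hom[OF presheaf_dist, of A p a "()"] by (simp add: star_simps)

lemma presheaf_eqI:
  assumes "presheaf Q A p" "presheaf Q A q" "fst p = fst q"
    and "\<And>a. a \<in> obj A \<Longrightarrow> snd p a () = snd q a ()"
  shows "p = q"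
proof (rule prod_eqI)
  show "snd p = snd q"
    using assms presheaf_dist[of A p] presheaf_dist[of A q]
    by (intro dist_eqI[of "star Q (fst p)" A]) simp_all
qed (rule assms)

lemma presheaf_cat_simps:
  "p \<in> obj (presheaf_cat Q A) \<longleftrightarrow> presheaf Q A p"
  "ty (presheaf_cat Q A) = fst"
  by (simp_all add: presheaf_cat_def)

lemma presheaf_arr_hom:
  assumes "qcategory Q A" "presheaf Q A q" "presheaf Q A p"
  shows "arr (presheaf_cat Q A) q p \<in> hom (fst p) (fst q)"
  using dist_hom[OF lifting_dist[OF star_qcategory star_qcategory assms(1) presheaf_dist presheaf_dist],
      of p q "()" "()"] assms presheaf_Obj[OF assms(2)] presheaf_Obj[OF assms(3)]
  by (simp add: presheaf_cat_def star_simps)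

text \<open>The lifting between two one-object categories has a single entry, so its adjunction is
  the universal property of a hom-arrow of P(A).\<close>

lemma le_presheaf_arr_iff:
  assumes "qcategory Q A" "presheaf Q A q" "presheaf Q A p" "u \<in> hom (fst p) (fst q)"
  shows "u \<sqsubseteq>\<^bsub>Hom Q (fst p) (fst q)\<^esub> arr (presheaf_cat Q A) q p \<longleftrightarrow>
    (\<forall>a\<in>obj A. snd q a () \<cdot> u \<sqsubseteq>\<^bsub>Hom Q (fst p) (ty A a)\<^esub> snd p a ())"
  using le_lifting_iff[OF star_qcategory star_qcategory assms(1) presheaf_dist presheaf_dist,
      of p q "()" "()" u] assms presheaf_Obj[OF assms(2)] presheaf_Obj[OF assms(3)]
  by (simp add: presheaf_cat_def star_simps)

lemma cmp_presheaf_arr_le: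
  assumes "qcategory Q A" "presheaf Q A q" "presheaf Q A p" "a \<in> obj A"
  shows "snd q a () \<cdot> arr (presheaf_cat Q A) q p \<sqsubseteq>\<^bsub>Hom Q (fst p) (ty A a)\<^esub> snd p a ()"
  using le_presheaf_arr_iff[OF assms(1-3) presheaf_arr_hom[OF assms(1-3)]]
    hom_refl[OF presheaf_Obj[OF assms(3)] presheaf_Obj[OF assms(2)] presheaf_arr_hom[OF assms(1-3)]]
    assms(4) by simp

text \<open>Both axioms are checked by the universal property: the identity is admissible by the
  unit law, and a composite of hom-arrows by associativity and two applications of
  \<open>cmp_presheaf_arr_le\<close>.\<close>

lemma presheaf_cat_qcategory:
  assumes A: "qcategory Q A"
  shows "qcategory Q (presheaf_cat Q A)"
proof -
  let ?P = "presheaf_cat Q A"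
  have idn: "idn Q (fst p) \<sqsubseteq>\<^bsub>Hom Q (fst p) (fst p)\<^esub> arr ?P p p" if p: "presheaf Q A p" for p
  proof -
    have "snd p a () \<cdot> idn Q (fst p) = snd p a ()" if "a \<in> obj A" for a
      using idn_right presheaf_Obj[OF p] ty_Obj[OF A that] presheaf_hom[OF p that] by blast
    then show ?thesis
      using presheaf_Obj[OF p] presheaf_hom[OF p] ty_Obj[OF A]
      by (simp add: le_presheaf_arr_iff[OF A p p] idn_closed hom_refl)
  qed
  have cmp: "arr ?P r q \<cdot> arr ?P q p \<sqsubseteq>\<^bsub>Hom Q (fst p) (fst r)\<^esub> arr ?P r p"
    if p: "presheaf Q A p" and q: "presheaf Q A q" and r: "presheaf Q A r" for p q r
  proof (subst le_presheaf_arr_iff[OF A r p])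
    note typing = presheaf_Obj[OF p] presheaf_Obj[OF q] presheaf_Obj[OF r] ty_Obj[OF A]
      presheaf_hom[OF p] presheaf_hom[OF q] presheaf_hom[OF r]
      presheaf_arr_hom[OF A q p] presheaf_arr_hom[OF A r q]
    show "arr ?P r q \<cdot> arr ?P q p \<in> hom (fst p) (fst r)"
      using typing cmp_closed by metis
    show "\<forall>a\<in>obj A. snd r a () \<cdot> (arr ?P r q \<cdot> arr ?P q p)
        \<sqsubseteq>\<^bsub>Hom Q (fst p) (ty A a)\<^esub> snd p a ()"
    proof
      fix a assume a: "a \<in> obj A"
      have "snd r a () \<cdot> (arr ?P r q \<cdot> arr ?P q p) = (snd r a () \<cdot> arr ?P r q) \<cdot> arr ?P q p"
        using a typing
        by (intro cmp_assoc[symmetric, of "fst p" "fst q" "fst r" "ty A a"]) auto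
      moreover have "(snd r a () \<cdot> arr ?P r q) \<cdot> arr ?P q p \<sqsubseteq>\<^bsub>Hom Q (fst p) (ty A a)\<^esub> snd p a ()"
        by (rule hom_trans[OF cmp_mono_left[OF _ _ _ _ _ _ cmp_presheaf_arr_le[OF A r q a]]
              cmp_presheaf_arr_le[OF A q p a]])
          (use a typing cmp_closed in metis)+
      ultimately show "snd r a () \<cdot> (arr ?P r q \<cdot> arr ?P q p)
          \<sqsubseteq>\<^bsub>Hom Q (fst p) (ty A a)\<^esub> snd p a ()"
        by simp
    qed
  qed
  show ?thesis
    using presheaf_Obj presheaf_arr_hom[OF A] idn cmp
    by (auto simp: qcategory_def presheaf_cat_simps)
qed

text \<open>It suffices to test r = p and r = q. For r = q, the identity lies below P(A)(q,q) =
  P(A)(p,q), which by the universal property says that p is below q in every entry; r = p gives the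
  converse.\<close>

lemma presheaf_cat_separated:
  assumes A: "qcategory Q A" and p: "presheaf Q A p" and q: "presheaf Q A q" and ty: "fst p = fst q"
    and eq: "\<And>r. presheaf Q A r \<Longrightarrow> arr (presheaf_cat Q A) p r = arr (presheaf_cat Q A) q r"
  shows "p = q"
proof (rule presheaf_eqI[OF p q ty])
  fix a assume a: "a \<in> obj A"
  have le: "snd r a () \<sqsubseteq>\<^bsub>Hom Q (fst r) (ty A a)\<^esub> snd s a ()"
    if r: "presheaf Q A r" and s: "presheaf Q A s" and ty: "fst r = fst s"
      and eq: "arr (presheaf_cat Q A) r s = arr (presheaf_cat Q A) s s" for r s
  proof -
    have "idn Q (fst s) \<sqsubseteq>\<^bsub>Hom Q (fst s) (fst r)\<^esub> arr (presheaf_cat Q A) r s"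
      using idn_le_arr[OF presheaf_cat_qcategory[OF A], of s] s ty eq
      by (simp add: presheaf_cat_simps)
    then have "snd r a () \<cdot> idn Q (fst s) \<sqsubseteq>\<^bsub>Hom Q (fst s) (ty A a)\<^esub> snd s a ()"
      using le_presheaf_arr_iff[OF A r s, of "idn Q (fst s)"] a ty idn_closed presheaf_Obj[OF s]
      by simp
    then show ?thesis
      using idn_right[OF _ _ presheaf_hom[OF r a]] presheaf_Obj[OF r] ty_Obj[OF A a] ty by simp
  qed
  show "snd p a () = snd q a ()"
    using le[OF p q ty eq[OF q]] le[OF q p ty[symmetric] eq[OF p, symmetric]]
      presheaf_hom[OF p a] presheaf_hom[OF q a] presheaf_Obj[OF p] ty_Obj[OF A a] ty
    by (intro hom_antisym[of "fst p" "ty A a"]) simp_all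
qed

section \<open>Functors, the Yoneda lemma and weighted colimits\<close>

lemma functor_obj: "\<lbrakk>qfunctor Q A B F; a \<in> obj A\<rbrakk> \<Longrightarrow> F a \<in> obj B"
  by (auto simp: qfunctor_def)

lemma functor_ty: "\<lbrakk>qfunctor Q A B F; a \<in> obj A\<rbrakk> \<Longrightarrow> ty B (F a) = ty A a"
  by (auto simp: qfunctor_def)

lemma functor_arr_le:
  "\<lbrakk>qfunctor Q A B F; a' \<in> obj A; a \<in> obj A\<rbrakk>
   \<Longrightarrow> arr A a' a \<sqsubseteq>\<^bsub>Hom Q (ty A a) (ty A a')\<^esub> arr B (F a') (F a)"
  by (auto simp: qfunctor_def)

text \<open>Enlarge u to B(Fa,b), then A(a',a) to B(Fa',Fa), and compose in B. With u = B(Fa,b) this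
  is the left action law of B(F-,-); with general u it is one half of the Yoneda lemma.\<close>

lemma functor_arr_cmp_le:
  assumes A: "qcategory Q A" and B: "qcategory Q B" and F: "qfunctor Q A B F"
    and a: "a \<in> obj A" "a' \<in> obj A" and b: "b \<in> obj B"
    and u: "u \<in> hom (ty B b) (ty A a)" "u \<sqsubseteq>\<^bsub>Hom Q (ty B b) (ty A a)\<^esub> arr B (F a) b"
  shows "arr A a' a \<cdot> u \<sqsubseteq>\<^bsub>Hom Q (ty B b) (ty A a')\<^esub> arr B (F a') b"
proof -
  note typing = ty_Obj[OF A a(1)] ty_Obj[OF A a(2)] ty_Obj[OF B b] u(1) arr_hom[OF A a(2,1)]
    arr_hom[OF B functor_obj[OF F a(1)] b, unfolded functor_ty[OF F a(1)]]
    arr_hom[OF B functor_obj[OF F a(2)] b, unfolded functor_ty[OF F a(2)]]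
    arr_hom[OF B functor_obj[OF F a(2)] functor_obj[OF F a(1)],
      unfolded functor_ty[OF F a(1)] functor_ty[OF F a(2)]]
  have "arr A a' a \<cdot> u \<sqsubseteq>\<^bsub>Hom Q (ty B b) (ty A a')\<^esub> arr A a' a \<cdot> arr B (F a) b"
    by (rule cmp_mono_right[OF _ _ _ _ _ _ u(2)]) (use typing in simp_all)
  moreover have "arr A a' a \<cdot> arr B (F a) b
      \<sqsubseteq>\<^bsub>Hom Q (ty B b) (ty A a')\<^esub> arr B (F a') (F a) \<cdot> arr B (F a) b"
    by (rule cmp_mono_left[OF _ _ _ _ _ _ functor_arr_le[OF F a(2,1)]]) (use typing in simp_all)
  moreover have "arr B (F a') (F a) \<cdot> arr B (F a) b
      \<sqsubseteq>\<^bsub>Hom Q (ty B b) (ty A a')\<^esub> arr B (F a') b"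
    using arr_cmp_le[OF B functor_obj[OF F a(2)] functor_obj[OF F a(1)] b] functor_ty[OF F a(2)]
    by simp
  moreover have "arr A a' a \<cdot> u \<in> hom (ty B b) (ty A a')"
    "arr A a' a \<cdot> arr B (F a) b \<in> hom (ty B b) (ty A a')"
    "arr B (F a') (F a) \<cdot> arr B (F a) b \<in> hom (ty B b) (ty A a')"
    using typing cmp_closed by metis+
  ultimately show ?thesis
    using typing hom_trans[of "ty B b" "ty A a'"] by metis
qed

lemma functor_dist_distributor:
  assumes A: "qcategory Q A" and B: "qcategory Q B" and F: "qfunctor Q A B F"
  shows "distributor Q B A (functor_dist A B F)"
  unfolding functor_dist_def
proof (rule dist_matI)
  fix a b assume a: "a \<in> obj A" and b: "b \<in> obj B"
  show hom: "arr B (F a) b \<in> hom (ty B b) (ty A a)" if "a \<in> obj A" for a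
    using arr_hom[OF B functor_obj[OF F that] b] functor_ty[OF F that] by simp
  show "arr B (F a) b' \<cdot> arr B b' b \<sqsubseteq>\<^bsub>Hom Q (ty B b) (ty A a)\<^esub> arr B (F a) b"
    if "b' \<in> obj B" for b'
    using arr_cmp_le[OF B functor_obj[OF F a] that b] functor_ty[OF F a] by simp
  show "arr A a a' \<cdot> arr B (F a') b \<sqsubseteq>\<^bsub>Hom Q (ty B b) (ty A a)\<^esub> arr B (F a) b"
    if a': "a' \<in> obj A" for a'
    by (rule functor_arr_cmp_le[OF A B F a' a b hom[OF a']])
      (use hom[OF a'] hom_refl ty_Obj[OF A a'] ty_Obj[OF B b] in simp)
qed

text \<open>This is [A(-,s), B(F-,b)] = B(Fs,b), tested on u. For the direct implication evaluate at
  a = s and use that the identity lies below A(s,s).\<close>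

lemma yoneda_le_iff:
  assumes A: "qcategory Q A" and B: "qcategory Q B" and F: "qfunctor Q A B F"
    and s: "s \<in> obj A" and b: "b \<in> obj B" and u: "u \<in> hom (ty B b) (ty A s)"
  shows "(\<forall>a\<in>obj A. arr A a s \<cdot> u \<sqsubseteq>\<^bsub>Hom Q (ty B b) (ty A a)\<^esub> arr B (F a) b) \<longleftrightarrow>
    u \<sqsubseteq>\<^bsub>Hom Q (ty B b) (ty A s)\<^esub> arr B (F s) b"
proof
  assume "u \<sqsubseteq>\<^bsub>Hom Q (ty B b) (ty A s)\<^esub> arr B (F s) b"
  then show "\<forall>a\<in>obj A. arr A a s \<cdot> u \<sqsubseteq>\<^bsub>Hom Q (ty B b) (ty A a)\<^esub> arr B (F a) b"
    using functor_arr_cmp_le[OF A B F s _ b u] by blast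
next
  assume "\<forall>a\<in>obj A. arr A a s \<cdot> u \<sqsubseteq>\<^bsub>Hom Q (ty B b) (ty A a)\<^esub> arr B (F a) b"
  then have le: "arr A s s \<cdot> u \<sqsubseteq>\<^bsub>Hom Q (ty B b) (ty A s)\<^esub> arr B (F s) b"
    using s by blast
  note typing = ty_Obj[OF A s] ty_Obj[OF B b] u arr_hom[OF A s s] idn_closed[OF ty_Obj[OF A s]]
    arr_hom[OF B functor_obj[OF F s] b, unfolded functor_ty[OF F s]]
  have "idn Q (ty A s) \<cdot> u \<sqsubseteq>\<^bsub>Hom Q (ty B b) (ty A s)\<^esub> arr A s s \<cdot> u"
    by (rule cmp_mono_left[OF _ _ _ _ _ _ idn_le_arr[OF A s]]) (use typing in simp_all)
  then have "u \<sqsubseteq>\<^bsub>Hom Q (ty B b) (ty A s)\<^esub> arr A s s \<cdot> u"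
    using typing idn_left[of "ty B b" "ty A s" u] by simp
  then show "u \<sqsubseteq>\<^bsub>Hom Q (ty B b) (ty A s)\<^esub> arr B (F s) b"
    by (rule hom_trans[OF _ le]) (use typing cmp_closed in metis)+
qed

text \<open>The defining equation of distributors is compared entry by entry, and each entry through
  the arrows below it, so that the lifting disappears from the criterion.\<close>

lemma is_colim_iff:
  assumes A: "qcategory Q A" and B: "qcategory Q B" and F: "qfunctor Q A B F"
    and p: "presheaf Q A p" and c: "c \<in> obj B" "ty B c = fst p"
  shows "is_colim Q A B p F c \<longleftrightarrow>
    (\<forall>b\<in>obj B. \<forall>u\<in>hom (ty B b) (fst p). u \<sqsubseteq>\<^bsub>Hom Q (ty B b) (fst p)\<^esub> arr B c b \<longleftrightarrow>
      (\<forall>a\<in>obj A. snd p a () \<cdot> u \<sqsubseteq>\<^bsub>Hom Q (ty B b) (ty A a)\<^esub> arr B (F a) b))"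
proof -
  let ?S = "star Q (fst p)"
  let ?D = "functor_dist ?S B (\<lambda>_. c)"
  let ?L = "lifting Q B ?S A (snd p) (functor_dist A B F)"
  note S = star_qcategory[OF presheaf_Obj[OF p]]
  note lift = B S A functor_dist_distributor[OF A B F] presheaf_dist[OF p]
  \<comment> \<open>The constant map is a functor because the only hom-arrow of the one-object
    category is the identity, which lies below B(c,c). Hence B(c,-) is a distributor.\<close>
  have "qfunctor Q ?S B (\<lambda>_. c)"
    using c idn_le_arr[OF B c(1)] by (auto simp: qfunctor_def star_simps)
  then have D: "distributor Q B ?S ?D"
    by (rule functor_dist_distributor[OF S B])
  have L: "distributor Q B ?S ?L"
    by (rule lifting_dist[OF lift])
  have D_eq: "?D () b = arr B c b" if "b \<in> obj B" for b
    using that by (simp add: functor_dist_def mat_apply star_simps)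
  have L_hom: "?L () b \<in> hom (ty B b) (fst p)" if "b \<in> obj B" for b
    using dist_hom[OF L, of "()" b] that by (simp add: star_simps)
  have le_L: "u \<sqsubseteq>\<^bsub>Hom Q (ty B b) (fst p)\<^esub> ?L () b \<longleftrightarrow>
      (\<forall>a\<in>obj A. snd p a () \<cdot> u \<sqsubseteq>\<^bsub>Hom Q (ty B b) (ty A a)\<^esub> arr B (F a) b)"
    if "b \<in> obj B" "u \<in> hom (ty B b) (fst p)" for b u
    using le_lifting_iff[OF lift, of "()" b u] that
    by (simp add: star_simps functor_dist_def mat_apply)
  have "is_colim Q A B p F c \<longleftrightarrow> (\<forall>b\<in>obj B. arr B c b = ?L () b)"
  proof
    assume "is_colim Q A B p F c"
    then show "\<forall>b\<in>obj B. arr B c b = ?L () b"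
      using D_eq by (simp add: is_colim_def)
  next
    assume "\<forall>b\<in>obj B. arr B c b = ?L () b"
    then show "is_colim Q A B p F c"
      using D_eq c by (auto simp: is_colim_def intro!: dist_eqI[OF D L])
  qed
  also have "\<dots> \<longleftrightarrow> (\<forall>b\<in>obj B. \<forall>u\<in>hom (ty B b) (fst p).
      u \<sqsubseteq>\<^bsub>Hom Q (ty B b) (fst p)\<^esub> arr B c b \<longleftrightarrow> u \<sqsubseteq>\<^bsub>Hom Q (ty B b) (fst p)\<^esub> ?L () b)"
    using arr_hom[OF B c(1)] c(2) L_hom ty_Obj[OF B] presheaf_Obj[OF p]
    by (auto intro!: hom_eqI[of "ty B _" "fst p"])
  finally show ?thesis
    using le_L by simp
qed

section \<open>Suprema of representables as weights\<close>

lemma rep_dist_distributor: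
  assumes A: "qcategory Q A" and a: "a \<in> obj A"
  shows "distributor Q (star Q (ty A a)) A (rep_dist A a)"
proof -
  have "arr A x a \<cdot> idn Q (ty A a) = arr A x a" if "x \<in> obj A" for x
    using idn_right ty_Obj[OF A a] ty_Obj[OF A that] arr_hom[OF A that a] by blast
  then show ?thesis
    unfolding rep_dist_def
    using dist_matI[of A "star Q (ty A a)" "\<lambda>x _. arr A x a"]
      a arr_hom[OF A] arr_cmp_le[OF A] ty_Obj[OF A]
    by (simp add: star_simps hom_refl)
qed

lemma rep_sup_apply:
  assumes "qcategory Q A" "X \<in> Obj Q" "S \<subseteq> {a \<in> obj A. ty A a = X}" "a \<in> obj A"
  shows "(\<Squnion>\<^bsub>Dist Q (star Q X) A\<^esub> (rep_dist A ` S)) a () =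
    \<Squnion>\<^bsub>Hom Q X (ty A a)\<^esub> (arr A a ` S)"
proof -
  have "distributor Q (star Q X) A \<Phi>" if "\<Phi> \<in> rep_dist A ` S" for \<Phi>
    using that assms rep_dist_distributor[of A] by auto
  then show ?thesis
    using assms
    by (simp add: Dist_sup[OF star_qcategory assms(1)] mat_apply star_simps image_image rep_dist_def)
qed

text \<open>The criterion says that B(c,-) is the infimum of the B(Fs,-) with s in S. For empty S
  this makes every B(c,b) the top arrow.\<close>

lemma conical_is_colim_iff:
  assumes A: "qcategory Q A" and B: "qcategory Q B" and F: "qfunctor Q A B F"
    and p: "presheaf Q A p" and S: "S \<subseteq> {a \<in> obj A. ty A a = fst p}"
    and p_eq: "snd p = \<Squnion>\<^bsub>Dist Q (star Q (fst p)) A\<^esub> (rep_dist A ` S)"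
    and c: "c \<in> obj B" "ty B c = fst p"
  shows "is_colim Q A B p F c \<longleftrightarrow>
    (\<forall>b\<in>obj B. \<forall>u\<in>hom (ty B b) (fst p). u \<sqsubseteq>\<^bsub>Hom Q (ty B b) (fst p)\<^esub> arr B c b \<longleftrightarrow>
      (\<forall>s\<in>S. u \<sqsubseteq>\<^bsub>Hom Q (ty B b) (fst p)\<^esub> arr B (F s) b))"
proof -
  have "(\<forall>a\<in>obj A. snd p a () \<cdot> u \<sqsubseteq>\<^bsub>Hom Q (ty B b) (ty A a)\<^esub> arr B (F a) b) \<longleftrightarrow>
      (\<forall>s\<in>S. u \<sqsubseteq>\<^bsub>Hom Q (ty B b) (fst p)\<^esub> arr B (F s) b)"
    if b: "b \<in> obj B" and u: "u \<in> hom (ty B b) (fst p)" for b u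
  proof -
    have "snd p a () \<cdot> u \<sqsubseteq>\<^bsub>Hom Q (ty B b) (ty A a)\<^esub> arr B (F a) b \<longleftrightarrow>
        (\<forall>s\<in>S. arr A a s \<cdot> u \<sqsubseteq>\<^bsub>Hom Q (ty B b) (ty A a)\<^esub> arr B (F a) b)" if a: "a \<in> obj A" for a
    proof -
      have "arr A a ` S \<subseteq> hom (fst p) (ty A a)"
        by (rule arr_image_hom[OF A a S])
      moreover have "arr B (F a) b \<in> hom (ty B b) (ty A a)"
        using arr_hom[OF B functor_obj[OF F a] b] functor_ty[OF F a] by simp
      moreover have "snd p a () = \<Squnion>\<^bsub>Hom Q (fst p) (ty A a)\<^esub> (arr A a ` S)"
        unfolding p_eq by (rule rep_sup_apply[OF A presheaf_Obj[OF p] S a])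
      ultimately show ?thesis
        using u ty_Obj[OF B b] ty_Obj[OF A a] presheaf_Obj[OF p]
        by (simp add: cmp_sup_left_le_iff)
    qed
    \<comment> \<open>The quantifiers over a and s are exchanged, so that the Yoneda lemma applies
      for each fixed s.\<close>
    then have "(\<forall>a\<in>obj A. snd p a () \<cdot> u \<sqsubseteq>\<^bsub>Hom Q (ty B b) (ty A a)\<^esub> arr B (F a) b) \<longleftrightarrow>
        (\<forall>s\<in>S. \<forall>a\<in>obj A. arr A a s \<cdot> u \<sqsubseteq>\<^bsub>Hom Q (ty B b) (ty A a)\<^esub> arr B (F a) b)"
      by blast
    also have "\<dots> \<longleftrightarrow> (\<forall>s\<in>S. u \<sqsubseteq>\<^bsub>Hom Q (ty B b) (fst p)\<^esub> arr B (F s) b)"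
    proof (rule ball_cong[OF HOL.refl])
      fix s assume "s \<in> S"
      then have "s \<in> obj A" "ty A s = fst p" using S by auto
      then show "(\<forall>a\<in>obj A. arr A a s \<cdot> u \<sqsubseteq>\<^bsub>Hom Q (ty B b) (ty A a)\<^esub> arr B (F a) b) \<longleftrightarrow>
          u \<sqsubseteq>\<^bsub>Hom Q (ty B b) (fst p)\<^esub> arr B (F s) b"
        using yoneda_le_iff[OF A B F _ b, of s u] u by simp
    qed
    finally show ?thesis .
  qed
  then show ?thesis
    unfolding is_colim_iff[OF A B F p c] by simp
qed

text \<open>Two colimits c and d satisfy P(B)(c,-) = P(B)(d,-), both being the same lifting;
  separatedness gives c = d, which leaves the choice operator no freedom.\<close>

lemma colim_presheaf_cat_eqI:
  assumes B: "qcategory Q B" and c: "is_colim Q A (presheaf_cat Q B) p G c"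
  shows "colim Q A (presheaf_cat Q B) p G = c"
  unfolding colim_def
proof (rule some_equality[where P = "is_colim Q A (presheaf_cat Q B) p G", OF c])
  fix d assume d: "is_colim Q A (presheaf_cat Q B) p G d"
  have *: "presheaf Q B c" "presheaf Q B d" "fst c = fst p" "fst d = fst p"
    using c d by (auto simp: is_colim_def presheaf_cat_simps)
  have eq: "functor_dist (star Q (fst p)) (presheaf_cat Q B) (\<lambda>_. c) =
      functor_dist (star Q (fst p)) (presheaf_cat Q B) (\<lambda>_. d)"
    using c d by (simp add: is_colim_def)
  show "d = c"
  proof (rule presheaf_cat_separated[OF B])
    fix r assume "presheaf Q B r"
    then show "arr (presheaf_cat Q B) d r = arr (presheaf_cat Q B) c r"
      using fun_cong[OF fun_cong[OF eq, of "()"], of r]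
      by (simp add: functor_dist_def mat_apply star_simps presheaf_cat_simps)
  qed (use * in simp_all)
qed

section \<open>The two closure conditions of a saturated class\<close>

text \<open>The singleton family of a itself is the witness.\<close>

lemma representable_conical:
  assumes A: "qcategory Q A" and a: "a \<in> obj A"
  shows "conical Q A (representable A a)"
proof -
  have rep: "rep_dist A a \<in> carrier (Dist Q (star Q (ty A a)) A)"
    using rep_dist_distributor[OF A a] by (simp add: Dist_def)
  interpret partial_order "Dist Q (star Q (ty A a)) A"
    by (rule Dist_partial_order[OF star_qcategory[OF ty_Obj[OF A a]] A])
  have "rep_dist A a = \<Squnion>\<^bsub>Dist Q (star Q (ty A a)) A\<^esub> (rep_dist A ` {a})"
    using rep by simp
  moreover have "{a} \<subseteq> {x \<in> obj A. ty A x = ty A a}"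
    using a by simp
  ultimately show ?thesis
    using rep ty_Obj[OF A a] unfolding conical_def presheaf_def representable_def fst_conv snd_conv
    by blast
qed

lemma conical_colim:
  assumes A: "qcategory Q A" and B: "qcategory Q B" and p: "conical Q A p"
    and G: "qfunctor Q A (presheaf_cat Q B) G"
    and G_conical: "\<And>a. a \<in> obj A \<Longrightarrow> conical Q B (G a)"
  shows "conical Q B (colim Q A (presheaf_cat Q B) p G)"
proof -
  define X where "X = fst p"
  have pp: "presheaf Q A p" and X: "X \<in> Obj Q"
    using p by (auto simp: conical_def presheaf_def X_def)
  obtain S where S: "S \<subseteq> {a \<in> obj A. ty A a = X}"
    and p_eq: "snd p = \<Squnion>\<^bsub>Dist Q (star Q X) A\<^esub> (rep_dist A ` S)"
    using p by (auto simp: conical_def X_def)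
  \<comment> \<open>G preserves types and every s has type X, so the families presenting the
    \<open>G s\<close> all consist of objects of type X and may be pooled.\<close>
  have Gp: "presheaf Q B (G s)" and fst_G: "fst (G s) = X" if "s \<in> S" for s
    using that S G_conical functor_ty[OF G, of s]
    by (auto simp: conical_def presheaf_cat_simps)
  have "\<exists>T. \<forall>s\<in>S. T s \<subseteq> {b \<in> obj B. ty B b = X} \<and>
      snd (G s) = \<Squnion>\<^bsub>Dist Q (star Q X) B\<^esub> (rep_dist B ` T s)"
  proof (rule bchoice, rule ballI)
    fix s assume s: "s \<in> S"
    then have "conical Q B (G s)" using S G_conical by auto
    then show "\<exists>T. T \<subseteq> {b \<in> obj B. ty B b = X} \<and>
        snd (G s) = \<Squnion>\<^bsub>Dist Q (star Q X) B\<^esub> (rep_dist B ` T)"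
      unfolding conical_def fst_G[OF s] by blast
  qed
  then obtain T where T_all: "\<forall>s\<in>S. T s \<subseteq> {b \<in> obj B. ty B b = X} \<and>
      snd (G s) = \<Squnion>\<^bsub>Dist Q (star Q X) B\<^esub> (rep_dist B ` T s)" ..
  then have T: "T s \<subseteq> {b \<in> obj B. ty B b = X}"
    and G_eq: "snd (G s) = \<Squnion>\<^bsub>Dist Q (star Q X) B\<^esub> (rep_dist B ` T s)" if "s \<in> S" for s
    using that by simp_all
  \<comment> \<open>Pooling the chosen families makes c conical by construction; that it is the
    supremum of the \<open>G s\<close> is what remains to be seen.\<close>
  define U where "U = (\<Union>s\<in>S. T s)"
  define c where "c = (X, \<Squnion>\<^bsub>Dist Q (star Q X) B\<^esub> (rep_dist B ` U))"
  have U: "U \<subseteq> {b \<in> obj B. ty B b = X}"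
    using T by (auto simp: U_def)
  have reps: "distributor Q (star Q X) B \<Phi>" if "\<Phi> \<in> rep_dist B ` U" for \<Phi>
    using that U rep_dist_distributor[OF B] by auto
  have c: "presheaf Q B c"
    using dist_sup[OF star_qcategory[OF X] B reps] Dist_sup[OF star_qcategory[OF X] B reps] X
    by (simp add: presheaf_def c_def Dist_def)
  \<comment> \<open>A supremum over the union U is a supremum over S of suprema over the
    \<open>T s\<close>, and the inner ones are the entries of the \<open>G s\<close>.\<close>
  have c_apply: "snd c b () = \<Squnion>\<^bsub>Hom Q X (ty B b)\<^esub> ((\<lambda>s. snd (G s) b ()) ` S)" if b: "b \<in> obj B" for b
  proof -
    have "(\<lambda>s. snd (G s) b ()) ` S = (\<lambda>s. \<Squnion>\<^bsub>Hom Q X (ty B b)\<^esub> (arr B b ` T s)) ` S"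
      using G_eq rep_sup_apply[OF B X T b] by (auto intro!: image_cong)
    moreover have "arr B b ` T s \<subseteq> hom X (ty B b)" if "s \<in> S" for s
      by (rule arr_image_hom[OF B b T[OF that]])
    ultimately show ?thesis
      using rep_sup_apply[OF B X U b] hom_sup_UN[OF X ty_Obj[OF B b], of S "\<lambda>s. arr B b ` T s"]
      by (simp add: c_def U_def image_UN)
  qed
  have "is_colim Q A (presheaf_cat Q B) p G c"
  proof (subst conical_is_colim_iff[OF A presheaf_cat_qcategory[OF B] G pp S[unfolded X_def]
        p_eq[unfolded X_def]])
    show "\<forall>r\<in>obj (presheaf_cat Q B). \<forall>u\<in>hom (ty (presheaf_cat Q B) r) (fst p).
        u \<sqsubseteq>\<^bsub>Hom Q (ty (presheaf_cat Q B) r) (fst p)\<^esub> arr (presheaf_cat Q B) c r \<longleftrightarrow>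
        (\<forall>s\<in>S. u \<sqsubseteq>\<^bsub>Hom Q (ty (presheaf_cat Q B) r) (fst p)\<^esub> arr (presheaf_cat Q B) (G s) r)"
      unfolding presheaf_cat_simps X_def[symmetric]
    proof (intro ballI)
      fix r u assume "r \<in> obj (presheaf_cat Q B)" and u: "u \<in> hom (fst r) X"
      then have r: "presheaf Q B r" by (simp add: presheaf_cat_simps)
      have "u \<sqsubseteq>\<^bsub>Hom Q (fst r) X\<^esub> arr (presheaf_cat Q B) c r \<longleftrightarrow>
          (\<forall>b\<in>obj B. snd c b () \<cdot> u \<sqsubseteq>\<^bsub>Hom Q (fst r) (ty B b)\<^esub> snd r b ())"
        using le_presheaf_arr_iff[OF B c r] u by (simp add: c_def)
      also have "\<dots> \<longleftrightarrow>
          (\<forall>b\<in>obj B. \<forall>s\<in>S. snd (G s) b () \<cdot> u \<sqsubseteq>\<^bsub>Hom Q (fst r) (ty B b)\<^esub> snd r b ())"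
      proof (rule ball_cong[OF HOL.refl])
        fix b assume b: "b \<in> obj B"
        have "(\<lambda>s. snd (G s) b ()) ` S \<subseteq> hom X (ty B b)"
          using presheaf_hom[OF Gp b] fst_G by auto
        then show "snd c b () \<cdot> u \<sqsubseteq>\<^bsub>Hom Q (fst r) (ty B b)\<^esub> snd r b () \<longleftrightarrow>
            (\<forall>s\<in>S. snd (G s) b () \<cdot> u \<sqsubseteq>\<^bsub>Hom Q (fst r) (ty B b)\<^esub> snd r b ())"
          using X u presheaf_Obj[OF r] ty_Obj[OF B b] presheaf_hom[OF r b]
          by (simp add: c_apply[OF b] cmp_sup_left_le_iff)
      qed
      \<comment> \<open>For fixed s, the condition over all b is the universal property of P(B)(G s,
        r).\<close>
      also have "\<dots> \<longleftrightarrow> (\<forall>s\<in>S. u \<sqsubseteq>\<^bsub>Hom Q (fst r) X\<^esub> arr (presheaf_cat Q B) (G s) r)"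
        using le_presheaf_arr_iff[OF B Gp r] u fst_G by auto
      finally show "u \<sqsubseteq>\<^bsub>Hom Q (fst r) X\<^esub> arr (presheaf_cat Q B) c r \<longleftrightarrow>
          (\<forall>s\<in>S. u \<sqsubseteq>\<^bsub>Hom Q (fst r) X\<^esub> arr (presheaf_cat Q B) (G s) r)" .
    qed
  qed (use c in \<open>simp_all add: presheaf_cat_simps c_def X_def\<close>)
  then have "colim Q A (presheaf_cat Q B) p G = c"
    by (rule colim_presheaf_cat_eqI[OF B])
  moreover have "conical Q B c"
    using c U by (auto simp: conical_def c_def)
  ultimately show ?thesis by simp
qed

end

theorem proposition5p3:
  fixes Q :: "('o, 'm) quantaloid"
  assumes "quantaloid Q"
  shows "saturated Q (conical_presheaves Q :: ('o, 'm, 'u) presheaf_class)"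
proof -
  interpret quantaloid Q by (rule assms)
  have "(conical_presheaves Q :: ('o, 'm, 'u) presheaf_class) \<subseteq> all_presheaves Q"
    by (auto simp: conical_presheaves_def all_presheaves_def conical_def)
  then show ?thesis
    unfolding saturated_def conical_presheaves_def mem_Collect_eq case_prod_conv
    by (intro conjI allI impI ballI) (simp_all add: representable_conical conical_colim)
qed

end
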